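(* Let $\Gamma$ be a group admitting a faithful, minimal, non-elementary convergence action on a compact metrizable space $X$ with more than two points. Then there is a set $I\subset\Gamma$ which contains exactly one representative of every non-trivial conjugacy class of $\Gamma$ (and no other elements), such that $I$ is independent and the subgroup $\langle I\rangle$ generated by $I$ is a proper subgroup of $\Gamma$, i.e. $\langle I\rangle\lneqq\Gamma$.
   Context: All actions are by homeomorphisms. Let a group $\Gamma$ act on a compact Hausdorff space $X$. An infinite subset $\Phi\subset\Gamma$ is collapsing if there are (not necessarily distinct) points $a,r\in X$ such that for all compact sets $K\subset X\setminus\{r\}$ and $L\subset X\setminus\{a\}$ the set $\{\phi\in\Phi:\phi\cdot K\cap L\neq\emptyset\}$ is finite. The action is a convergence action if every infinite subset $\Phi\subset\Gamma$ contains an infinite collapsing subset $\Phi'\subset\Phi$. A convergence group is a group admitting a convergence action on some compact metrizable space with more than two points. The convergence action is elementary if $\Gamma$ is finite or $\Gamma$ stabilizes (setwise) a nonempty subset of $X$ with at most $2$ elements; otherwise it is non-elementary. The action is minimal if every orbit is dense in $X$, and faithful if only the identity acts trivially. A conjugacy class is non-trivial if it is not $\{1\}$. A subset $I$ of a group is independent if the subgroup $\langle I\rangle$ it generates is the free product of the cyclic groups $\langle\gamma\rangle$, $\gamma\in I$ (that is, the natural homomorphism from the abstract free product $*_{\gamma\in I}\langle\gamma\rangle$ onto $\langle I\rangle$ is an isomorphism). *)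

theory Defs
  imports "HOL-Analysis.Analysis" "HOL-Algebra.Group_Action" "HOL-Algebra.Generated_Groups"
begin

section \<open>Convergence actions\<close>

text \<open>
  Following HOL-Algebra, an action of \<open>G\<close> on \<open>topspace X\<close> is a homomorphism to
  \<^term>\<open>BijGroup (topspace X)\<close>, so that each \<open>\<phi> g\<close> is undefined outside of
  \<open>topspace X\<close>.
\<close>

locale homeo_action = group_action G "topspace X" \<phi>
  for G (structure) and X and \<phi> +
  assumes homeo: "g \<in> carrier G \<Longrightarrow> homeomorphic_map X X (\<phi> g)"

definition collapsing :: "'x topology \<Rightarrow> ('g \<Rightarrow> 'x \<Rightarrow> 'x) \<Rightarrow> 'g set \<Rightarrow> bool" where
  "collapsing X \<phi> \<Phi> \<longleftrightarrow> infinite \<Phi> \<and>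
     (\<exists>a \<in> topspace X. \<exists>r \<in> topspace X. \<forall>K L.
        compactin X K \<and> K \<subseteq> topspace X - {r} \<and>
        compactin X L \<and> L \<subseteq> topspace X - {a} \<longrightarrow>
        finite {g \<in> \<Phi>. \<phi> g ` K \<inter> L \<noteq> {}})"

locale convergence_action = homeo_action +
  assumes compact: "compact_space X"
    and Hausdorff: "Hausdorff_space X"
    and convergence: "\<lbrakk>\<Phi> \<subseteq> carrier G; infinite \<Phi>\<rbrakk> \<Longrightarrow> \<exists>\<Phi>' \<subseteq> \<Phi>. collapsing X \<phi> \<Phi>'"

definition elementary_action ::
  "('g, 'm) monoid_scheme \<Rightarrow> 'x topology \<Rightarrow> ('g \<Rightarrow> 'x \<Rightarrow> 'x) \<Rightarrow> bool" where
  "elementary_action G X \<phi> \<longleftrightarrow> finite (carrier G) \<or>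
     (\<exists>S \<subseteq> topspace X. S \<noteq> {} \<and> finite S \<and> card S \<le> 2 \<and>
        (\<forall>g \<in> carrier G. \<phi> g ` S = S))"

definition minimal_action ::
  "('g, 'm) monoid_scheme \<Rightarrow> 'x topology \<Rightarrow> ('g \<Rightarrow> 'x \<Rightarrow> 'x) \<Rightarrow> bool" where
  "minimal_action G X \<phi> \<longleftrightarrow>
     (\<forall>x \<in> topspace X. X closure_of (orbit G \<phi> x) = topspace X)"


section \<open>Conjugacy classes\<close>

definition conjugacy_class :: "('g, 'm) monoid_scheme \<Rightarrow> 'g \<Rightarrow> 'g set" where
  "conjugacy_class G g = {h \<otimes>\<^bsub>G\<^esub> g \<otimes>\<^bsub>G\<^esub> inv\<^bsub>G\<^esub> h | h. h \<in> carrier G}"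

definition nontrivial_conjugacy_classes :: "('g, 'm) monoid_scheme \<Rightarrow> 'g set set" where
  "nontrivial_conjugacy_classes G = conjugacy_class G ` carrier G - {{\<one>\<^bsub>G\<^esub>}}"


section \<open>Free products\<close>

text \<open>
  The free product of a family of groups \<open>H i\<close>, \<open>i \<in> I\<close>: words in the disjoint union of the
  carriers, modulo multiplication of adjacent letters of the same factor and deletion of the
  identities.
\<close>

definition fp_words :: "('i \<Rightarrow> ('a, 'm) monoid_scheme) \<Rightarrow> 'i set \<Rightarrow> ('i \<times> 'a) list set" where
  "fp_words H I = lists (SIGMA i:I. carrier (H i))"

inductive_set fp_rel ::
  "('i \<Rightarrow> ('a, 'm) monoid_scheme) \<Rightarrow> 'i set \<Rightarrow> (('i \<times> 'a) list \<times> ('i \<times> 'a) list) set"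
  for H :: "'i \<Rightarrow> ('a, 'm) monoid_scheme" and I :: "'i set" where
  refl: "u \<in> fp_words H I \<Longrightarrow> (u, u) \<in> fp_rel H I"
| sym: "(u, v) \<in> fp_rel H I \<Longrightarrow> (v, u) \<in> fp_rel H I"
| trans: "\<lbrakk>(u, v) \<in> fp_rel H I; (v, w) \<in> fp_rel H I\<rbrakk> \<Longrightarrow> (u, w) \<in> fp_rel H I"
| one: "\<lbrakk>u \<in> fp_words H I; v \<in> fp_words H I; i \<in> I\<rbrakk>
    \<Longrightarrow> (u @ [(i, \<one>\<^bsub>H i\<^esub>)] @ v, u @ v) \<in> fp_rel H I"
| mult: "\<lbrakk>u \<in> fp_words H I; v \<in> fp_words H I; i \<in> I; x \<in> carrier (H i); y \<in> carrier (H i)\<rbrakk>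
    \<Longrightarrow> (u @ [(i, x), (i, y)] @ v, u @ [(i, x \<otimes>\<^bsub>H i\<^esub> y)] @ v) \<in> fp_rel H I"

definition free_product ::
  "('i \<Rightarrow> ('a, 'm) monoid_scheme) \<Rightarrow> 'i set \<Rightarrow> ('i \<times> 'a) list set monoid" where
  "free_product H I =
     \<lparr>carrier = fp_words H I // fp_rel H I,
      mult = \<lambda>A B. \<Union>u\<in>A. \<Union>v\<in>B. fp_rel H I `` {u @ v},
      one = fp_rel H I `` {[]}\<rparr>"

text \<open>
  The homomorphism from the free product to \<open>K\<close> induced by homomorphisms \<open>f i\<close> from \<open>H i\<close> to
  \<open>K\<close>: it takes the same value on all the words of a class, whence \<^const>\<open>the_elem\<close>.
\<close>

definition free_product_lift ::
  "('b, 'n) monoid_scheme \<Rightarrow> ('i \<Rightarrow> 'a \<Rightarrow> 'b) \<Rightarrow> ('i \<times> 'a) list set \<Rightarrow> 'b" where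
  "free_product_lift K f A =
     the_elem ((\<lambda>w. foldr (\<lambda>(i, x) y. f i x \<otimes>\<^bsub>K\<^esub> y) w \<one>\<^bsub>K\<^esub>) ` A)"

text \<open>
  The factors are indexed by the elements of \<open>I\<close>: two elements of \<open>I\<close> that generate the same
  subgroup contribute two factors.
\<close>

definition independent_in :: "('g, 'm) monoid_scheme \<Rightarrow> 'g set \<Rightarrow> bool" where
  "independent_in G I \<longleftrightarrow> I \<subseteq> carrier G \<and>
     free_product_lift G (\<lambda>_ x. x)
       \<in> iso (free_product (\<lambda>\<gamma>. G\<lparr>carrier := generate G {\<gamma>}\<rparr>) I)
             (G\<lparr>carrier := generate G I\<rparr>)"

end

theory Submission
  imports Defs
begin

text \<open>
  The proof is a game of ping-pong with infinitely many players.  Suppose that disjoint nonempty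
  open sets \<open>V 0, V 1, V 2, \<dots>\<close> of \<open>X\<close> are given and that every nontrivial conjugacy class \<open>C\<close> has
  its own index \<open>n > 0\<close> and a representative \<open>\<gamma>\<close> all of whose nontrivial powers map the complement of
  \<open>V n\<close> into \<open>V n\<close>.  A point \<open>x\<close> of \<open>V 0\<close> lies in none of the sets \<open>V n\<close> with \<open>n > 0\<close>, so a nonempty
  reduced word in the powers of the representatives moves \<open>x\<close> into one of these sets.  Hence the
  representatives are independent.  Moreover the orbit of \<open>x\<close> under the subgroup that they generate
  meets \<open>V 0\<close> in \<open>x\<close> alone, whereas the orbit under \<open>G\<close> is dense and \<open>V 0\<close> is infinite: the
  subgroup is proper.

  A representative as required comes from two facts.  First, if \<open>\<gamma>\<close> is nontrivial, some nonempty
  open set \<open>U\<close> is disjoint from its images under all the nontrivial powers of \<open>\<gamma>\<close>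
  (\<open>cyclic_displaced_open\<close>).  Second, for all nonempty open sets \<open>U\<close> and \<open>V\<close> some \<open>h\<close> maps the
  complement of \<open>U\<close> into \<open>V\<close> (\<open>push_into\<close>).  The nontrivial powers of \<open>\<gamma>\<close> map \<open>U\<close> into its complement,
  so those of the conjugate of \<open>\<gamma>\<close> by \<open>h\<close> map the complement of \<open>V\<close>, which lies in \<open>h U\<close>, into \<open>V\<close>.

  The second fact holds because an infinite collapsing set with attracting point \<open>a\<close> and repelling
  point \<open>r\<close> contains elements that map the complement of any given neighbourhood of \<open>r\<close> into any
  given neighbourhood of \<open>a\<close>; by minimality \<open>a\<close> and \<open>r\<close> can be translated into \<open>V\<close> and \<open>U\<close>.  For the
  first fact, every infinite collapsing set of powers of \<open>\<gamma>\<close> has its attracting and repelling points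
  among the fixed points of \<open>\<gamma>\<close>.  So a point that \<open>\<gamma>\<close> moves has a closed neighbourhood that meets its
  images under only finitely many powers, and finitely many nontrivial elements can be dealt with by
  shrinking the neighbourhood, because none of them fixes a nonempty open set pointwise
  (\<open>topologically_free\<close>).

  Finally, there are only countably many conjugacy classes, since the images of a fixed triple of
  distinct points under an infinite set of group elements cannot stay uniformly separated
  (\<open>countable_group\<close>).
\<close>

section \<open>Free products of subgroups\<close>

text \<open>
  The natural homomorphism from a free product of subgroups to the group is treated for an arbitrary
  indexed family of subgroups: it is an isomorphism onto the subgroup that they generate as soon
  as no nonempty reduced word has value \<open>\<one>\<close>.
\<close>

locale subgroup_family = group G for G (structure) +
  fixes H :: "'i \<Rightarrow> 'a set" and I :: "'i set"
  assumes subgroup_factor: "i \<in> I \<Longrightarrow> subgroup (H i) G"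
begin

abbreviation words :: "('i \<times> 'a) list set"
  where "words \<equiv> fp_words (\<lambda>i. G\<lparr>carrier := H i\<rparr>) I"

abbreviation word_rel :: "(('i \<times> 'a) list \<times> ('i \<times> 'a) list) set"
  where "word_rel \<equiv> fp_rel (\<lambda>i. G\<lparr>carrier := H i\<rparr>) I"

definition word_value :: "('i \<times> 'a) list \<Rightarrow> 'a"
  where "word_value w = foldr (\<lambda>(_, x) y. x \<otimes> y) w \<one>"

definition reduced_word :: "('i \<times> 'a) list \<Rightarrow> bool"
  where "reduced_word w \<longleftrightarrow> (\<forall>p \<in> set w. snd p \<noteq> \<one>) \<and> successively (\<lambda>p q. fst p \<noteq> fst q) w"

definition inverse_word :: "('i \<times> 'a) list \<Rightarrow> ('i \<times> 'a) list"
  where "inverse_word w = rev (map (\<lambda>(i, x). (i, inv x)) w)"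

lemma factor_closed [simp]: "i \<in> I \<Longrightarrow> x \<in> H i \<Longrightarrow> x \<in> carrier G"
  by (rule subgroup.mem_carrier[OF subgroup_factor])

lemma Nil_in_words [simp]: "[] \<in> words"
  by (simp add: fp_words_def)

lemma Cons_in_words [simp]: "p # w \<in> words \<longleftrightarrow> fst p \<in> I \<and> snd p \<in> H (fst p) \<and> w \<in> words"
  by (cases p) (auto simp: fp_words_def)

lemma append_in_words [simp]: "u @ v \<in> words \<longleftrightarrow> u \<in> words \<and> v \<in> words"
  by (auto simp: fp_words_def)

lemma inverse_word_in_words [simp]: "w \<in> words \<Longrightarrow> inverse_word w \<in> words"
  by (induction w) (auto simp: inverse_word_def subgroup.m_inv_closed[OF subgroup_factor])

lemma word_value_Nil [simp]: "word_value [] = \<one>"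
  and word_value_Cons [simp]: "word_value (p # w) = snd p \<otimes> word_value w"
  by (auto simp: word_value_def split: prod.split)

lemma word_value_closed [simp]: "w \<in> words \<Longrightarrow> word_value w \<in> carrier G"
  by (induction w) auto

lemma word_value_append:
  "u \<in> words \<Longrightarrow> v \<in> words \<Longrightarrow> word_value (u @ v) = word_value u \<otimes> word_value v"
  by (induction u) (auto simp: m_assoc)

lemma word_rel_in_words: "(u, v) \<in> word_rel \<Longrightarrow> u \<in> words \<and> v \<in> words"
  by (induction rule: fp_rel.induct)
    (auto simp: subgroup.one_closed[OF subgroup_factor] subgroup.m_closed[OF subgroup_factor])

lemma word_value_cong: "(u, v) \<in> word_rel \<Longrightarrow> word_value u = word_value v"
proof (induction rule: fp_rel.induct)
  case (one u v i)
  then show ?case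
    using subgroup.one_closed[OF subgroup_factor] by (simp add: word_value_append)
next
  case (mult u v i x y)
  then show ?case
    using subgroup.m_closed[OF subgroup_factor] by (simp add: word_value_append m_assoc)
qed auto

text \<open>
  The relation is a congruence for concatenation: every elementary move takes place between
  arbitrary words on the left and on the right, so it can be carried out inside a longer word.
\<close>

lemma word_rel_append:
  assumes "(u, v) \<in> word_rel" "p \<in> words" "q \<in> words"
  shows "(p @ u @ q, p @ v @ q) \<in> word_rel"
  using assms
proof (induction rule: fp_rel.induct)
  case (refl u)
  then show ?case by (intro fp_rel.refl) auto
next
  case (sym u v)
  then show ?case by (blast intro: fp_rel.sym)
next
  case (trans u v w)
  then show ?case by (blast intro: fp_rel.trans)
next
  case (one u v i)
  then show ?case
    using fp_rel.one[of "p @ u" "\<lambda>i. G\<lparr>carrier := H i\<rparr>" I "v @ q" i] by simp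
next
  case (mult u v i x y)
  then show ?case
    using fp_rel.mult[of "p @ u" "\<lambda>i. G\<lparr>carrier := H i\<rparr>" I "v @ q" i x y] by simp
qed

lemma word_rel_mult:
  assumes "(u, u') \<in> word_rel" "(v, v') \<in> word_rel"
  shows "(u @ v, u' @ v') \<in> word_rel"
proof -
  have "(u @ v, u' @ v) \<in> word_rel"
    using word_rel_append[of u u' "[]" v] assms word_rel_in_words by simp
  moreover have "(u' @ v, u' @ v') \<in> word_rel"
    using word_rel_append[of v v' u' "[]"] assms word_rel_in_words by simp
  ultimately show ?thesis by (rule fp_rel.trans)
qed

lemma equiv_word_rel: "equiv words word_rel"
proof (rule equivI)
  show "refl_on words word_rel"
    by (auto intro!: refl_onI fp_rel.refl)
  show "word_rel \<subseteq> words \<times> words"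
    using word_rel_in_words by auto
  show "sym word_rel"
    by (auto intro!: symI fp_rel.sym)
  show "trans word_rel"
    by (auto intro!: transI intro: fp_rel.trans)
qed

lemma word_rel_cancel:
  assumes "i \<in> I" "x \<in> H i" "w \<in> words" "w' \<in> words"
  shows "(w @ [(i, inv x), (i, x)] @ w', w @ w') \<in> word_rel"
proof -
  have "(w @ [(i, inv x), (i, x)] @ w', w @ [(i, \<one>)] @ w') \<in> word_rel"
    using fp_rel.mult[of w "\<lambda>i. G\<lparr>carrier := H i\<rparr>" I w' i "inv x" x] assms
      subgroup.m_inv_closed[OF subgroup_factor] by simp
  moreover have "(w @ [(i, \<one>)] @ w', w @ w') \<in> word_rel"
    using fp_rel.one[of w "\<lambda>i. G\<lparr>carrier := H i\<rparr>" I w' i] assms by simp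
  ultimately show ?thesis by (rule fp_rel.trans)
qed

lemma inverse_word_append_rel: "w \<in> words \<Longrightarrow> (inverse_word w @ w, []) \<in> word_rel"
proof (induction w)
  case Nil
  then show ?case by (simp add: inverse_word_def fp_rel.refl)
next
  case (Cons p w)
  obtain i x where p: "p = (i, x)" by (cases p)
  have "(inverse_word w @ [(i, inv x), (i, x)] @ w, inverse_word w @ w) \<in> word_rel"
    using Cons.prems p by (intro word_rel_cancel) auto
  moreover have "inverse_word (p # w) @ p # w = inverse_word w @ [(i, inv x), (i, x)] @ w"
    by (simp add: inverse_word_def p)
  ultimately show ?case
    using Cons fp_rel.trans by fastforce
qed

text \<open>
  A letter put in front of a reduced word is deleted if it is trivial and merged with the first
  letter if both belong to the same factor.  In the second case the tail needs no further reduction: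
  its first letter belongs to another factor, and it moves to the front if the merged letter is
  trivial.
\<close>

lemma reduced_word_exists: "w \<in> words \<Longrightarrow> \<exists>v. (w, v) \<in> word_rel \<and> reduced_word v"
proof (induction w)
  case Nil
  have "([], []) \<in> word_rel" "reduced_word []"
    by (simp_all add: reduced_word_def fp_rel.refl)
  then show ?case by blast
next
  case (Cons p w)
  obtain i x where p: "p = (i, x)" by (cases p)
  have ix: "i \<in> I" "x \<in> H i" using Cons.prems p by auto
  obtain v where v: "(w, v) \<in> word_rel" "reduced_word v"
    using Cons by auto
  have v_words: "v \<in> words" using v word_rel_in_words by blast
  have pv: "(p # w, (i, x) # v) \<in> word_rel"
    using word_rel_append[OF v(1), of "[p]" "[]"] Cons.prems p by simp
  have drop_one: "((i, \<one>) # u, u) \<in> word_rel" if "u \<in> words" for u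
    using fp_rel.one[of "[]" "\<lambda>i. G\<lparr>carrier := H i\<rparr>" I u i] that ix by simp
  consider "x = \<one>" | "x \<noteq> \<one>" "v = [] \<or> fst (hd v) \<noteq> i"
    | y v' where "x \<noteq> \<one>" "v = (i, y) # v'"
    by (cases v) fastforce+
  then show ?case
  proof cases
    case 1
    then show ?thesis
      using pv drop_one[OF v_words] v(2) fp_rel.trans by metis
  next
    case 2
    then have "reduced_word ((i, x) # v)"
      using v(2) by (auto simp: reduced_word_def successively_Cons)
    then show ?thesis using pv by blast
  next
    case 3
    have y: "y \<in> H i" "v' \<in> words" using v_words 3 by auto
    have "((i, x) # v, (i, x \<otimes> y) # v') \<in> word_rel"
      using fp_rel.mult[of "[]" "\<lambda>i. G\<lparr>carrier := H i\<rparr>" I v' i x y] ix y 3 by simp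
    then have rel: "(p # w, (i, x \<otimes> y) # v') \<in> word_rel"
      using pv fp_rel.trans by metis
    have v': "reduced_word v'"
      using v(2) 3 by (auto simp: reduced_word_def successively_Cons)
    show ?thesis
    proof (cases "x \<otimes> y = \<one>")
      case True
      then have "(p # w, v') \<in> word_rel"
        using rel drop_one[OF y(2)] fp_rel.trans by metis
      then show ?thesis using v' by blast
    next
      case False
      then have "reduced_word ((i, x \<otimes> y) # v')"
        using v(2) 3 by (auto simp: reduced_word_def successively_Cons)
      then show ?thesis using rel by blast
    qed
  qed
qed

lemma word_value_image: "word_value ` words = generate G (\<Union>i\<in>I. H i)"
proof
  show "word_value ` words \<subseteq> generate G (\<Union>i\<in>I. H i)"
  proof clarify
    fix w assume "w \<in> words"
    then show "word_value w \<in> generate G (\<Union>i\<in>I. H i)"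
      by (induction w) (auto intro: generate.intros)
  qed
  show "generate G (\<Union>i\<in>I. H i) \<subseteq> word_value ` words"
  proof
    fix g assume "g \<in> generate G (\<Union>i\<in>I. H i)"
    then show "g \<in> word_value ` words"
    proof (induction rule: generate.induct)
      case one
      have "\<one> = word_value []" by simp
      then show ?case using Nil_in_words by blast
    next
      case (incl h)
      then obtain i where i: "i \<in> I" "h \<in> H i" by auto
      then have "h = word_value [(i, h)]" "[(i, h)] \<in> words" by auto
      then show ?case by blast
    next
      case (inv h)
      then obtain i where i: "i \<in> I" "h \<in> H i" by auto
      then have "inv h = word_value [(i, inv h)]" "[(i, inv h)] \<in> words"
        using subgroup.m_inv_closed[OF subgroup_factor] by auto
      then show ?case by blast
    next
      case (eng h1 h2)
      then obtain u v where "u \<in> words" "v \<in> words" "h1 = word_value u" "h2 = word_value v"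
        by auto
      then have "h1 \<otimes> h2 = word_value (u @ v)" "u @ v \<in> words"
        by (auto simp: word_value_append)
      then show ?case by blast
    qed
  qed
qed

lemma free_product_lift_class:
  assumes "w \<in> words"
  shows "free_product_lift G (\<lambda>_ x. x) (word_rel `` {w}) = word_value w"
proof -
  have "w \<in> word_rel `` {w}"
    using fp_rel.refl[OF assms] by (rule ImageI) simp
  moreover have "word_value v = word_value w" if "v \<in> word_rel `` {w}" for v
    using that word_value_cong[of w v] by simp
  ultimately have "word_value ` (word_rel `` {w}) = {word_value w}"
    by blast
  then show ?thesis
    unfolding free_product_lift_def word_value_def by (simp add: case_prod_unfold)
qed

lemma free_product_mult_class:
  assumes "u \<in> words" "v \<in> words"
  shows "word_rel `` {u} \<otimes>\<^bsub>free_product (\<lambda>i. G\<lparr>carrier := H i\<rparr>) I\<^esub> word_rel `` {v}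
    = word_rel `` {u @ v}"
proof -
  let ?R = word_rel
  have eq: "?R `` {u' @ v'} = ?R `` {u @ v}" if "u' \<in> ?R `` {u}" "v' \<in> ?R `` {v}" for u' v'
  proof -
    have "(u @ v, u' @ v') \<in> ?R"
      using that by (intro word_rel_mult) auto
    then show ?thesis
      using equiv_class_eq[OF equiv_word_rel] by metis
  qed
  have "(\<Union>u'\<in>?R `` {u}. \<Union>v'\<in>?R `` {v}. ?R `` {u' @ v'})
    = (\<Union>u'\<in>?R `` {u}. \<Union>v'\<in>?R `` {v}. ?R `` {u @ v})"
    by (intro SUP_cong HOL.refl eq)
  moreover have "u \<in> ?R `` {u}" "v \<in> ?R `` {v}"
    using assms by (simp_all add: fp_rel.refl)
  then have "(\<Union>u'\<in>?R `` {u}. \<Union>v'\<in>?R `` {v}. ?R `` {u @ v}) = ?R `` {u @ v}"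
    by blast
  ultimately show ?thesis
    by (simp add: free_product_def)
qed

text \<open>
  Every word is equivalent to a reduced one, so the assumption says that a word of value \<open>\<one>\<close> is
  equivalent to the empty word.  Injectivity follows, because the class of an explicit inverse word is
  inverse to the class of a word.
\<close>

theorem free_product_lift_iso:
  assumes nontrivial: "\<And>w. \<lbrakk>w \<in> words; reduced_word w; w \<noteq> []\<rbrakk> \<Longrightarrow> word_value w \<noteq> \<one>"
  shows "free_product_lift G (\<lambda>_ x. x)
    \<in> iso (free_product (\<lambda>i. G\<lparr>carrier := H i\<rparr>) I) (G\<lparr>carrier := generate G (\<Union>i\<in>I. H i)\<rparr>)"
    (is "?f \<in> iso ?F ?K")
proof -
  have carrier_F: "carrier ?F = words // word_rel"
    by (simp add: free_product_def)
  have kernel: "(w, []) \<in> word_rel" if "w \<in> words" "word_value w = \<one>" for w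
  proof -
    obtain v where v: "(w, v) \<in> word_rel" "reduced_word v"
      using reduced_word_exists \<open>w \<in> words\<close> by blast
    then have "word_value v = \<one>" "v \<in> words"
      using word_value_cong that(2) word_rel_in_words by auto
    then have "v = []" using nontrivial v(2) by blast
    then show ?thesis using v by simp
  qed
  have inj: "(u, v) \<in> word_rel" if uv: "u \<in> words" "v \<in> words" "word_value u = word_value v" for u v
  proof -
    have "word_value (inverse_word v) \<otimes> word_value v = \<one>"
      using word_value_cong[OF inverse_word_append_rel[OF uv(2)]] uv by (simp add: word_value_append)
    then have "word_value v \<otimes> word_value (inverse_word v) = \<one>"
      using uv by (simp add: inv_comm)
    then have "(u @ inverse_word v, []) \<in> word_rel"
      using uv by (intro kernel) (auto simp: word_value_append)
    then have "(u @ inverse_word v @ v, v) \<in> word_rel"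
      using word_rel_append[of "u @ inverse_word v" "[]" "[]" v] uv by simp
    moreover have "(u @ inverse_word v @ v, u) \<in> word_rel"
      using word_rel_append[OF inverse_word_append_rel[OF uv(2)], of u "[]"] uv by simp
    ultimately show ?thesis by (blast intro: fp_rel.sym fp_rel.trans)
  qed
  have "?f \<in> hom ?F ?K"
  proof (rule homI)
    fix A assume "A \<in> carrier ?F"
    then obtain u where "u \<in> words" "A = word_rel `` {u}"
      unfolding carrier_F by (auto elim: quotientE)
    then show "?f A \<in> carrier ?K"
      using word_value_image by (auto simp: free_product_lift_class)
  next
    fix A B assume "A \<in> carrier ?F" "B \<in> carrier ?F"
    then obtain u v where "u \<in> words" "A = word_rel `` {u}" "v \<in> words" "B = word_rel `` {v}"
      unfolding carrier_F by (meson quotientE)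
    then show "?f (A \<otimes>\<^bsub>?F\<^esub> B) = ?f A \<otimes>\<^bsub>?K\<^esub> ?f B"
      by (simp add: free_product_mult_class free_product_lift_class word_value_append)
  qed
  moreover have "inj_on ?f (carrier ?F)"
  proof (rule inj_onI)
    fix A B assume "A \<in> carrier ?F" "B \<in> carrier ?F" and eq: "?f A = ?f B"
    then obtain u v where uv: "u \<in> words" "A = word_rel `` {u}" "v \<in> words" "B = word_rel `` {v}"
      unfolding carrier_F by (meson quotientE)
    then have "(u, v) \<in> word_rel"
      using eq by (intro inj) (auto simp: free_product_lift_class)
    then show "A = B"
      using uv equiv_class_eq[OF equiv_word_rel] by blast
  qed
  moreover have "?f ` carrier ?F = carrier ?K"
  proof -
    have "carrier ?F = (\<lambda>w. word_rel `` {w}) ` words"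
      unfolding carrier_F quotient_def by blast
    then have "?f ` carrier ?F = word_value ` words"
      by (simp add: image_image free_product_lift_class cong: image_cong_simp)
    then show ?thesis by (simp add: word_value_image)
  qed
  ultimately show ?thesis
    by (simp add: iso_def bij_betw_def)
qed

end


section \<open>Group actions\<close>

context group_action
begin

lemma in_E [simp]: "g \<in> carrier G \<Longrightarrow> x \<in> E \<Longrightarrow> \<phi> g x \<in> E"
  using element_image by blast

lemma one_act [simp]: "x \<in> E \<Longrightarrow> \<phi> \<one> x = x"
  using id_eq_one by (metis restrict_apply')

lemma inv_act [simp]:
  assumes "g \<in> carrier G" "x \<in> E"
  shows "\<phi> (inv g) (\<phi> g x) = x" "\<phi> g (\<phi> (inv g) x) = x"
proof -
  interpret group G using group_hom group_hom.axioms(1) by auto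
  show "\<phi> (inv g) (\<phi> g x) = x"
    using assms orbit_sym_aux by blast
  show "\<phi> g (\<phi> (inv g) x) = x"
    using assms composition_rule[of x g "inv g"] by simp
qed

lemma faithful_imp_one:
  assumes "inj_on \<phi> (carrier G)" "g \<in> carrier G" "\<And>x. x \<in> E \<Longrightarrow> \<phi> g x = x"
  shows "g = \<one>"
proof -
  interpret group G using group_hom group_hom.axioms(1) by auto
  \<comment> \<open>Both maps are undefined outside \<open>E\<close>, so they agree there as well.\<close>
  have "\<phi> g \<in> extensional E" "\<phi> \<one> \<in> extensional E"
    using bij_prop0 assms(2) by (auto simp: Bij_def)
  then have "\<phi> g = \<phi> \<one>"
    using assms(3) by (intro extensionalityI) auto
  then show ?thesis
    using assms by (auto dest: inj_onD)
qed

end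


section \<open>The ping-pong lemma\<close>

text \<open>
  Two letters of a reduced word that belong to the same factor are never adjacent, so each letter is
  applied to a point outside its own target set: either to the base point, or to a point of the target
  set of the next letter on its right.
\<close>

locale ping_pong = group_action G E \<phi> + subgroup_family G H I
  for G (structure) and E and \<phi> and H and I +
  fixes V and x
  assumes disjoint_targets: "disjoint_family_on V I"
    and base_point: "x \<in> E" "\<And>i. i \<in> I \<Longrightarrow> x \<notin> V i"
    and ping_pong: "\<And>i h. \<lbrakk>i \<in> I; h \<in> H i; h \<noteq> \<one>\<rbrakk> \<Longrightarrow> \<phi> h ` (E - V i) \<subseteq> V i"
begin

lemma reduced_word_moves_base_point:
  "\<lbrakk>w \<in> words; reduced_word w; w \<noteq> []\<rbrakk> \<Longrightarrow> \<phi> (word_value w) x \<in> V (fst (hd w))"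
proof (induction w)
  case (Cons p w)
  obtain i h where p: "p = (i, h)" by (cases p)
  have ih: "i \<in> I" "h \<in> H i" "h \<noteq> \<one>" and w: "w \<in> words" "reduced_word w"
    using Cons.prems p by (auto simp: reduced_word_def successively_Cons)
  have E: "\<phi> (word_value w) x \<in> E"
    using w(1) base_point(1) by simp
  have "\<phi> (word_value w) x \<notin> V i"
  proof (cases "w = []")
    case True
    then show ?thesis using base_point ih by simp
  next
    case False
    then obtain q w' where q: "w = q # w'" by (cases w) auto
    have "\<phi> (word_value w) x \<in> V (fst q)"
      using Cons.IH w False q by simp
    moreover have "fst q \<noteq> i" "fst q \<in> I"
      using Cons.prems p q by (auto simp: reduced_word_def)
    ultimately show ?thesis
      using disjoint_targets ih by (auto simp: disjoint_family_on_def)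
  qed
  then have "\<phi> h (\<phi> (word_value w) x) \<in> V i"
    using ping_pong[OF ih] E by blast
  then show ?case
    using p ih w base_point(1) by (simp add: composition_rule)
qed auto

lemma reduced_word_nontrivial:
  assumes "w \<in> words" "reduced_word w" "w \<noteq> []"
  shows "word_value w \<noteq> \<one>"
proof
  assume "word_value w = \<one>"
  then have "\<phi> (word_value w) x = x"
    using base_point(1) by simp
  moreover have "fst (hd w) \<in> I"
    using assms by (cases w) auto
  ultimately show False
    using reduced_word_moves_base_point[OF assms] base_point(2) by metis
qed

text \<open>
  This confines the orbit of the base point under the generated subgroup, which is what
  distinguishes that subgroup from the whole group.
\<close>

lemma orbit_of_base_point:
  assumes "g \<in> generate G (\<Union>i\<in>I. H i)"
  shows "\<phi> g x = x \<or> \<phi> g x \<in> (\<Union>i\<in>I. V i)"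
proof -
  obtain w where w: "w \<in> words" "g = word_value w"
    using assms word_value_image by blast
  obtain v where v: "(w, v) \<in> word_rel" "reduced_word v"
    using reduced_word_exists w(1) by blast
  have g: "g = word_value v" and v_words: "v \<in> words"
    using v word_value_cong w word_rel_in_words by auto
  show ?thesis
  proof (cases "v = []")
    case True
    then show ?thesis
      using g base_point(1) by simp
  next
    case False
    then have "fst (hd v) \<in> I" using v_words by (cases v) auto
    then show ?thesis
      using reduced_word_moves_base_point[OF v_words v(2) False] g by blast
  qed
qed

end

lemma (in group) generate_Union_cyclic:
  assumes "I \<subseteq> carrier G"
  shows "generate G (\<Union>\<gamma>\<in>I. generate G {\<gamma>}) = generate G I"
proof
  have "generate G {\<gamma>} \<subseteq> generate G I" if "\<gamma> \<in> I" for \<gamma>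
    using that by (intro mono_generate) auto
  then show "generate G (\<Union>\<gamma>\<in>I. generate G {\<gamma>}) \<subseteq> generate G I"
    using generate_is_subgroup[OF assms] by (intro generate_subgroup_incl) auto
  show "generate G I \<subseteq> generate G (\<Union>\<gamma>\<in>I. generate G {\<gamma>})"
    by (intro mono_generate) (auto intro: generate.incl)
qed


section \<open>Conjugacy classes\<close>

context group
begin

lemma inv_mult_cancel:
  assumes "h \<in> carrier G" "z \<in> carrier G"
  shows "inv h \<otimes> (h \<otimes> z) = z" "h \<otimes> (inv h \<otimes> z) = z"
  using assms by (simp_all add: m_assoc[symmetric])

lemma conjugacy_class_cong:
  assumes "g \<in> carrier G" "k \<in> conjugacy_class G g"
  shows "conjugacy_class G k = conjugacy_class G g"
proof -
  obtain h where h: "h \<in> carrier G" "k = h \<otimes> g \<otimes> inv h"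
    using assms by (auto simp: conjugacy_class_def)
  have "\<exists>b \<in> carrier G. a \<otimes> k \<otimes> inv a = b \<otimes> g \<otimes> inv b" if "a \<in> carrier G" for a
    using that h assms
    by (intro bexI[of _ "a \<otimes> h"]) (auto simp: m_assoc inv_mult_group)
  moreover have "\<exists>b \<in> carrier G. a \<otimes> g \<otimes> inv a = b \<otimes> k \<otimes> inv b" if "a \<in> carrier G" for a
    using that h assms
    by (intro bexI[of _ "a \<otimes> inv h"]) (auto simp: m_assoc inv_mult_group inv_mult_cancel)
  ultimately show ?thesis
    unfolding conjugacy_class_def by blast
qed

lemma conjugacy_class_one: "conjugacy_class G \<one> = {\<one>}"
  by (auto simp: conjugacy_class_def intro: exI[of _ \<one>])

lemma generate_conjugate:
  assumes "g \<in> carrier G" "h \<in> carrier G" "k \<in> generate G {h \<otimes> g \<otimes> inv h}"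
  shows "\<exists>k' \<in> generate G {g}. k = h \<otimes> k' \<otimes> inv h"
  using assms(3)
proof (induction rule: generate.induct)
  case one
  then show ?case using assms by (intro bexI[of _ \<one>]) (auto intro: generate.one)
next
  case (incl a)
  then show ?case using assms by (intro bexI[of _ g]) (auto intro: generate.incl)
next
  case (inv a)
  then show ?case using assms
    by (intro bexI[of _ "inv g"]) (auto intro: generate.inv simp: inv_mult_group m_assoc)
next
  case (eng a b)
  then obtain a' b' where ab: "a' \<in> generate G {g}" "a = h \<otimes> a' \<otimes> inv h"
    "b' \<in> generate G {g}" "b = h \<otimes> b' \<otimes> inv h" by auto
  have "a' \<in> carrier G" "b' \<in> carrier G"
    using ab generate_in_carrier[of "{g}"] assms(1) by auto
  then have "a \<otimes> b = h \<otimes> (a' \<otimes> b') \<otimes> inv h"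
    using ab assms by (simp add: m_assoc inv_mult_cancel)
  then show ?case using ab(1,3) by (intro bexI[of _ "a' \<otimes> b'"] generate.eng)
qed

lemma generate_singleton_commutes:
  assumes "g \<in> carrier G" "k \<in> generate G {g}"
  shows "g \<otimes> k = k \<otimes> g"
  using assms(2)
proof (induction rule: generate.induct)
  case (eng a b)
  have "a \<in> carrier G" "b \<in> carrier G"
    using eng generate_in_carrier[of "{g}"] assms(1) by auto
  then show ?case using eng assms(1) by (metis m_assoc)
qed (use assms(1) in auto)

end


section \<open>Disjoint open sets\<close>

text \<open>
  Two points of an open set have disjoint neighbourhoods inside it.  Keeping one of them and splitting the other
  again, infinitely often, yields the sequence.
\<close>

lemma Hausdorff_space_disjoint_open_sequence:
  assumes "Hausdorff_space X" "topspace X \<noteq> {}"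
    and no_isolated: "\<And>U. \<lbrakk>openin X U; U \<noteq> {}\<rbrakk> \<Longrightarrow> infinite U"
  obtains V :: "nat \<Rightarrow> 'a set"
  where "\<And>n. openin X (V n)" "\<And>n. V n \<noteq> {}" "disjoint_family V"
proof -
  have "\<exists>A B. openin X A \<and> openin X B \<and> A \<noteq> {} \<and> B \<noteq> {} \<and> A \<subseteq> W \<and> B \<subseteq> W \<and> A \<inter> B = {}"
    if W: "openin X W" "W \<noteq> {}" for W
  proof -
    obtain p q where pq: "p \<in> W" "q \<in> W" "p \<noteq> q"
    proof -
      obtain p where "p \<in> W" using W by blast
      moreover have "\<not> W \<subseteq> {p}"
        using no_isolated[OF W] finite_subset by blast
      ultimately show ?thesis using that by blast
    qed
    moreover have "p \<in> topspace X" "q \<in> topspace X"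
      using pq openin_subset[OF W(1)] by auto
    ultimately obtain A B where "openin X A" "openin X B" "p \<in> A" "q \<in> B" "disjnt A B"
      using assms(1) unfolding Hausdorff_space_def by metis
    then show ?thesis
      using W pq by (intro exI[of _ "A \<inter> W"] exI[of _ "B \<inter> W"]) (auto simp: disjnt_def)
  qed
  then obtain A B where split: "\<And>W. openin X W \<Longrightarrow> W \<noteq> {} \<Longrightarrow>
      openin X (A W) \<and> openin X (B W) \<and> A W \<noteq> {} \<and> B W \<noteq> {} \<and> A W \<subseteq> W \<and> B W \<subseteq> W \<and> A W \<inter> B W = {}"
    by metis
  define W where "W n = (B ^^ n) (topspace X)" for n
  have W: "openin X (W n) \<and> W n \<noteq> {}" for n
  proof (induction n)
    case 0
    then show ?case using assms(2) by (simp add: W_def)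
  next
    case (Suc n)
    then show ?case using split[of "W n"] by (simp add: W_def)
  qed
  have step: "W (Suc n) \<subseteq> W n" "W (Suc n) \<inter> A (W n) = {}" for n
    using split[of "W n"] W[of n] by (auto simp: W_def)
  have mono: "W n \<subseteq> W m" if "m \<le> n" for m n
    using that step(1) by (rule lift_Suc_antimono_le[rotated])
  have "A (W m) \<inter> A (W n) = {}" if "m < n" for m n
    using mono[of "Suc m" n] that step(2)[of m] split[of "W n"] W[of n] by auto
  then have "A (W m) \<inter> A (W n) = {}" if "m \<noteq> n" for m n
    using that by (cases m n rule: linorder_cases) blast+
  then show ?thesis
    using split W by (intro that[of "\<lambda>n. A (W n)"]) (auto simp: disjoint_family_on_def)
qed


section \<open>Collapsing sets\<close>

context convergence_action
begin

sublocale group G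
  using group_hom group_hom.axioms(1) by blast

text \<open>
  The collapsing property with its attracting point \<open>a\<close> and its repelling point \<open>r\<close> made explicit.
  In a compact Hausdorff space closed sets may take the place of compact ones, and closed sets are
  what complements of neighbourhoods provide.  The infinitude of the set is kept apart as a
  separate assumption.
\<close>

definition collapses :: "'a set \<Rightarrow> 'c \<Rightarrow> 'c \<Rightarrow> bool"
  where "collapses \<Phi> a r \<longleftrightarrow> a \<in> topspace X \<and> r \<in> topspace X \<and>
    (\<forall>K L. closedin X K \<and> r \<notin> K \<and> closedin X L \<and> a \<notin> L \<longrightarrow>
      finite {g \<in> \<Phi>. \<phi> g ` K \<inter> L \<noteq> {}})"

lemma obtain_collapses:
  assumes "\<Phi> \<subseteq> carrier G" "infinite \<Phi>"
  obtains \<Phi>' a r where "\<Phi>' \<subseteq> \<Phi>" "infinite \<Phi>'" "collapses \<Phi>' a r"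
proof -
  obtain \<Phi>' where \<Phi>': "\<Phi>' \<subseteq> \<Phi>" "collapsing X \<phi> \<Phi>'"
    using convergence[OF assms] by blast
  then obtain a r where "infinite \<Phi>'" "a \<in> topspace X" "r \<in> topspace X"
    and finite: "\<And>K L. \<lbrakk>compactin X K; K \<subseteq> topspace X - {r}; compactin X L; L \<subseteq> topspace X - {a}\<rbrakk>
      \<Longrightarrow> finite {g \<in> \<Phi>'. \<phi> g ` K \<inter> L \<noteq> {}}"
    unfolding collapsing_def by blast
  moreover have "compactin X K" "K \<subseteq> topspace X - {b}" if "closedin X K" "b \<notin> K" for K b
    using that compact closedin_compact_space closedin_subset by blast+
  ultimately have "collapses \<Phi>' a r"
    unfolding collapses_def by meson
  then show ?thesis
    using that \<Phi>'(1) \<open>infinite \<Phi>'\<close> by blast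
qed

lemma collapses_finite:
  assumes "collapses \<Phi> a r" "closedin X K" "r \<notin> K" "closedin X L" "a \<notin> L"
  shows "finite {g \<in> \<Phi>. \<phi> g ` K \<inter> L \<noteq> {}}"
  using assms unfolding collapses_def by blast

text \<open>
  The dynamical form in which the collapsing property is used: some element of the set maps \<open>K\<close> into
  the neighbourhood \<open>A\<close> of the attracting point, because only finitely many fail to.
\<close>

lemma collapses_moves_into:
  assumes "collapses \<Phi> a r" "\<Phi> \<subseteq> carrier G" "infinite \<Phi>"
    and "closedin X K" "r \<notin> K" "openin X A" "a \<in> A"
  obtains g where "g \<in> \<Phi>" "\<phi> g ` K \<subseteq> A"
proof -
  have "finite {g \<in> \<Phi>. \<phi> g ` K \<inter> (topspace X - A) \<noteq> {}}"
    using assms by (intro collapses_finite) auto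
  then have "\<not> \<Phi> \<subseteq> {g \<in> \<Phi>. \<phi> g ` K \<inter> (topspace X - A) \<noteq> {}}"
    using assms(3) finite_subset by blast
  then obtain g where g: "g \<in> \<Phi>" "\<phi> g ` K \<inter> (topspace X - A) = {}" by blast
  have "\<phi> g ` K \<subseteq> topspace X"
    using g(1) assms(2,4) closedin_subset by fastforce
  then show ?thesis using that g by blast
qed

lemma closedin_finite [simp]: "finite K \<Longrightarrow> K \<subseteq> topspace X \<Longrightarrow> closedin X K"
  using Hausdorff Hausdorff_imp_t1_space t1_space_closedin_finite by blast

lemma openin_delete [simp]: "openin X U \<Longrightarrow> openin X (U - {p})"
  using Hausdorff Hausdorff_imp_t1_space t1_space_openin_delete_alt by blast

lemma openin_preimage:
  "g \<in> carrier G \<Longrightarrow> openin X U \<Longrightarrow> openin X {x \<in> topspace X. \<phi> g x \<in> U}"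
  using homeo homeomorphic_imp_continuous_map openin_continuous_map_preimage by blast

text \<open>
  The image of \<open>K\<close> under \<open>g\<close> meets \<open>L\<close> if and only if \<open>K\<close> meets the image of \<open>L\<close> under the inverse of
  \<open>g\<close>, so inversion exchanges the attracting and the repelling point.
\<close>

lemma collapses_inverse:
  assumes "collapses \<Phi> a r" "\<Phi> \<subseteq> carrier G"
  shows "collapses (m_inv G ` \<Phi>) r a"
  unfolding collapses_def
proof (intro conjI allI impI)
  fix K L assume KL: "closedin X K \<and> a \<notin> K \<and> closedin X L \<and> r \<notin> L"
  then have sub: "K \<subseteq> topspace X" "L \<subseteq> topspace X"
    by (auto dest: closedin_subset)
  have "{g \<in> m_inv G ` \<Phi>. \<phi> g ` K \<inter> L \<noteq> {}} \<subseteq> m_inv G ` {g \<in> \<Phi>. \<phi> g ` L \<inter> K \<noteq> {}}"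
  proof
    fix g' assume "g' \<in> {g \<in> m_inv G ` \<Phi>. \<phi> g ` K \<inter> L \<noteq> {}}"
    then obtain g x where g: "g \<in> \<Phi>" "g' = inv g" and x: "x \<in> K" "\<phi> (inv g) x \<in> L"
      by blast
    have "\<phi> g (\<phi> (inv g) x) = x"
      using g x sub assms(2) by (intro inv_act) auto
    then have "\<phi> g ` L \<inter> K \<noteq> {}" using x by (metis disjoint_iff imageI)
    then show "g' \<in> m_inv G ` {g \<in> \<Phi>. \<phi> g ` L \<inter> K \<noteq> {}}"
      using g by blast
  qed
  moreover have "finite {g \<in> \<Phi>. \<phi> g ` L \<inter> K \<noteq> {}}"
    using assms(1) KL by (intro collapses_finite) auto
  ultimately show "finite {g \<in> m_inv G ` \<Phi>. \<phi> g ` K \<inter> L \<noteq> {}}"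
    by (meson finite_imageI finite_subset)
qed (use assms in \<open>auto simp: collapses_def\<close>)

text \<open>
  A common fixed point \<open>p\<close> other than \<open>a\<close> and \<open>r\<close> would be a test set \<open>K = L = {p}\<close> that all the
  infinitely many elements map onto itself.
\<close>

lemma collapses_fixed_point:
  assumes "collapses \<Phi> a r" "infinite \<Phi>" "p \<in> topspace X" "\<And>g. g \<in> \<Phi> \<Longrightarrow> \<phi> g p = p"
  shows "p \<in> {a, r}"
proof (rule ccontr)
  assume "p \<notin> {a, r}"
  then have "finite {g \<in> \<Phi>. \<phi> g ` {p} \<inter> {p} \<noteq> {}}"
    using assms by (intro collapses_finite) auto
  moreover have "{g \<in> \<Phi>. \<phi> g ` {p} \<inter> {p} \<noteq> {}} = \<Phi>"
    using assms(4) by auto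
  ultimately show False using assms(2) by simp
qed

lemma displaced_neighbourhood:
  assumes "g \<in> carrier G" "x \<in> topspace X" "\<phi> g x \<noteq> x"
  obtains W where "openin X W" "x \<in> W" "\<phi> g ` W \<inter> W = {}"
proof -
  have "\<phi> g x \<in> topspace X" using assms by simp
  then obtain A B where AB: "openin X A" "openin X B" "x \<in> A" "\<phi> g x \<in> B" "disjnt A B"
    using Hausdorff assms unfolding Hausdorff_space_def by metis
  show ?thesis
  proof
    show "openin X (A \<inter> {y \<in> topspace X. \<phi> g y \<in> B})"
      using AB openin_preimage[OF assms(1)] by blast
  qed (use AB assms in \<open>auto simp: disjnt_def\<close>)
qed

lemma finite_triple_stabilizer:
  assumes "T \<subseteq> topspace X" "card T = 3"
  shows "finite {g \<in> carrier G. \<forall>x \<in> T. \<phi> g x = x}" (is "finite ?S")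
proof (rule ccontr)
  assume "infinite ?S"
  then obtain \<Phi> a r where \<Phi>: "\<Phi> \<subseteq> ?S" "infinite \<Phi>" "collapses \<Phi> a r"
    by (rule obtain_collapses[rotated]) auto
  then have "T \<subseteq> {a, r}"
    using collapses_fixed_point[OF \<Phi>(3,2)] assms(1) by blast
  then have "card T \<le> card {a, r}" by (intro card_mono) auto
  also have "\<dots> \<le> 2" by (simp add: card_insert_if)
  finally show False using assms(2) by simp
qed

end


section \<open>Minimality and the contraction of open sets\<close>

text \<open>
  The group is infinite when the action is non-elementary, and infinitude is what provides
  collapsing sets.
\<close>

locale minimal_convergence_action = convergence_action +
  assumes infinite_group: "infinite (carrier G)"
    and three_points: "\<exists>T \<subseteq> topspace X. card T = 3"
    and minimal: "minimal_action G X \<phi>"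
    and faithful: "inj_on \<phi> (carrier G)"
begin

lemma avoid_two_points: "\<exists>x \<in> topspace X. x \<noteq> p \<and> x \<noteq> q"
proof (rule ccontr)
  assume no: "\<not> ?thesis"
  obtain T where T: "T \<subseteq> topspace X" "card T = 3" using three_points by blast
  then have "card T \<le> card {p, q}" using no by (intro card_mono) auto
  also have "\<dots> \<le> 2" by (simp add: card_insert_if)
  finally show False using T(2) by simp
qed

lemma orbit_meets_open:
  assumes "x \<in> topspace X" "openin X U" "U \<noteq> {}"
  shows "\<exists>g \<in> carrier G. \<phi> g x \<in> U"
proof -
  obtain u where "u \<in> U" using assms by blast
  moreover have "u \<in> X closure_of (orbit G \<phi> x)"
    using minimal assms openin_subset \<open>u \<in> U\<close> unfolding minimal_action_def by blast
  ultimately show ?thesis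
    using assms(2) unfolding in_closure_of orbit_def by blast
qed

text \<open>
  An element of an infinite collapsing set squeezes the complement of any neighbourhood of the repelling
  point into any neighbourhood of the attracting point.  Minimality provides \<open>h\<close> and \<open>k\<close> that move the
  repelling point into \<open>U\<close> and the attracting point into \<open>V\<close>; composing with \<open>k\<close> and the inverse of
  \<open>h\<close> transports the squeezing to \<open>U\<close> and \<open>V\<close>.
\<close>

lemma push_into:
  assumes U: "openin X U" "U \<noteq> {}" and V: "openin X V" "V \<noteq> {}"
  shows "\<exists>g \<in> carrier G. \<phi> g ` (topspace X - U) \<subseteq> V"
proof -
  obtain \<Phi> a r where \<Phi>: "\<Phi> \<subseteq> carrier G" "infinite \<Phi>" "collapses \<Phi> a r"
    using obtain_collapses[OF _ infinite_group] by blast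
  then have ar: "a \<in> topspace X" "r \<in> topspace X" by (auto simp: collapses_def)
  obtain h where h: "h \<in> carrier G" "\<phi> h r \<in> U"
    using orbit_meets_open[OF ar(2) U] by blast
  obtain k where k: "k \<in> carrier G" "\<phi> k a \<in> V"
    using orbit_meets_open[OF ar(1) V] by blast
  let ?R = "{x \<in> topspace X. \<phi> h x \<in> U}" and ?A = "{x \<in> topspace X. \<phi> k x \<in> V}"
  obtain g where g: "g \<in> \<Phi>" "\<phi> g ` (topspace X - ?R) \<subseteq> ?A"
  proof (rule collapses_moves_into[OF \<Phi>(3,1,2)])
    show "closedin X (topspace X - ?R)" "openin X ?A"
      using openin_preimage[OF h(1) U(1)] openin_preimage[OF k(1) V(1)] by auto
  qed (use h k ar in auto)
  have g_carrier: "g \<in> carrier G" using g(1) \<Phi>(1) by blast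
  have "\<phi> (k \<otimes> g \<otimes> inv h) x \<in> V" if x: "x \<in> topspace X - U" for x
  proof -
    have "\<phi> (inv h) x \<in> topspace X - ?R" using x h(1) by simp
    then have "\<phi> g (\<phi> (inv h) x) \<in> ?A" using g(2) by blast
    then show ?thesis
      using x h(1) k(1) g_carrier by (simp add: composition_rule)
  qed
  then show ?thesis
    using h(1) k(1) g_carrier by (intro bexI[of _ "k \<otimes> g \<otimes> inv h"]) auto
qed

text \<open>
  If \<open>U\<close> were finite, some singleton would be open, and the complement of an open set that leaves out
  two points could be pushed into it, contrary to injectivity.
\<close>

lemma infinite_open:
  assumes "openin X U" "U \<noteq> {}"
  shows "infinite U"
proof
  assume "finite U"
  obtain p where p: "p \<in> U" using assms by blast
  have p_X: "p \<in> topspace X" using p assms(1) openin_subset by blast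
  have "closedin X (U - {p})"
    using \<open>finite U\<close> assms(1) openin_subset by (intro closedin_finite) auto
  then have "openin X (U - (U - {p}))" using assms(1) by (rule openin_diff[rotated])
  moreover have "U - (U - {p}) = {p}" using p by blast
  ultimately have open_p: "openin X {p}" by simp
  obtain q where q: "q \<in> topspace X" "q \<noteq> p" using avoid_two_points by blast
  obtain s where s: "s \<in> topspace X" "s \<noteq> p" "s \<noteq> q" using avoid_two_points by blast
  have "openin X (topspace X - {q, s})" using q s by (intro openin_diff) auto
  moreover have "p \<in> topspace X - {q, s}" using p_X q s by simp
  ultimately obtain g where g: "g \<in> carrier G" "\<phi> g ` (topspace X - (topspace X - {q, s})) \<subseteq> {p}"
    using push_into[OF _ _ open_p] by blast
  then have "\<phi> g q = \<phi> g s" using q s by blast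
  then show False using g(1) q s inj_prop by (auto dest: inj_onD)
qed

lemma obtain_disjoint_open_sequence:
  obtains V :: "nat \<Rightarrow> 'c set"
  where "\<And>n. openin X (V n)" "\<And>n. V n \<noteq> {}" "disjoint_family V"
proof -
  have "topspace X \<noteq> {}" using avoid_two_points by blast
  then show ?thesis
    using Hausdorff_space_disjoint_open_sequence[OF Hausdorff _ infinite_open] that by metis
qed


section \<open>Open sets displaced by a cyclic group\<close>

text \<open>
  If \<open>h\<close> fixes \<open>U\<close> pointwise, its conjugates can be made to act trivially outside any given nonempty
  open set.  Disjoint open sets then give infinitely many distinct elements.  All but the first of them
  fix the first open set pointwise, and this set is infinite; but the stabilizer of three points is
  finite.
\<close>

lemma topologically_free:
  assumes h: "h \<in> carrier G" "h \<noteq> \<one>" and U: "openin X U" "U \<noteq> {}"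
  shows "\<exists>x \<in> U. \<phi> h x \<noteq> x"
proof (rule ccontr)
  assume "\<not> ?thesis"
  then have fixed: "\<phi> h x = x" if "x \<in> U" for x using that by blast
  obtain V :: "nat \<Rightarrow> 'c set"
    where V: "\<And>n. openin X (V n)" "\<And>n. V n \<noteq> {}" "disjoint_family V"
    by (rule obtain_disjoint_open_sequence) blast
  have "\<exists>k \<in> carrier G. k \<noteq> \<one> \<and> (\<forall>x \<in> topspace X - V n. \<phi> k x = x)" for n
  proof -
    obtain g where g: "g \<in> carrier G" "\<phi> g ` (topspace X - U) \<subseteq> V n"
      using push_into[OF U V(1,2)] by blast
    have "\<phi> (g \<otimes> h \<otimes> inv g) x = x" if x: "x \<in> topspace X - V n" for x
    proof -
      have "\<phi> (inv g) x \<in> U"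
      proof (rule ccontr)
        assume "\<phi> (inv g) x \<notin> U"
        then have "\<phi> g (\<phi> (inv g) x) \<in> V n" using g x by (intro subsetD[OF g(2)] imageI) auto
        then show False using x g by simp
      qed
      then show ?thesis using x g h fixed by (simp add: composition_rule)
    qed
    moreover have "g \<otimes> h \<otimes> inv g \<noteq> \<one>"
    proof
      assume "g \<otimes> h \<otimes> inv g = \<one>"
      then have "inv g \<otimes> (g \<otimes> h \<otimes> inv g) \<otimes> g = \<one>" using g by simp
      then show False using g h by (simp add: m_assoc inv_mult_cancel)
    qed
    ultimately show ?thesis using g h by blast
  qed
  then obtain k where k: "\<And>n. k n \<in> carrier G" "\<And>n. k n \<noteq> \<one>"
    "\<And>n x. x \<in> topspace X - V n \<Longrightarrow> \<phi> (k n) x = x"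
    by metis
  have "inj k"
  proof (rule injI, rule ccontr)
    fix m n assume mn: "k m = k n" "m \<noteq> n"
    have "\<phi> (k n) x = x" if "x \<in> topspace X" for x
      using k(3)[of x n] k(3)[of x m] V(3) mn that by (auto simp: disjoint_family_on_def)
    then show False using faithful_imp_one[OF faithful k(1)] k(2) by blast
  qed
  obtain T where T: "T \<subseteq> V 0" "card T = 3"
    using infinite_arbitrarily_large[OF infinite_open[OF V(1,2)]] by metis
  have T_X: "T \<subseteq> topspace X" using T(1) openin_subset[OF V(1)] by blast
  have "k (Suc n) \<in> {g \<in> carrier G. \<forall>x \<in> T. \<phi> g x = x}" for n
  proof -
    have "V 0 \<inter> V (Suc n) = {}" using V(3) by (auto simp: disjoint_family_on_def)
    then show ?thesis using k T T_X by blast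
  qed
  then have "finite (range (\<lambda>n. k (Suc n)))"
    using finite_triple_stabilizer[OF T_X T(2)] by (meson finite_subset image_subsetI)
  moreover have "inj (\<lambda>n. k (Suc n))" using \<open>inj k\<close> by (intro injI) (auto dest: injD)
  ultimately show False using finite_imageD by fastforce
qed

text \<open>
  The elements of \<open>F\<close> are treated one at a time: by topological freeness each moves some point of the
  open set left over from the previous ones, and a small neighbourhood of that point is displaced.
\<close>

lemma displaced_open_subset:
  assumes "finite F" "F \<subseteq> carrier G - {\<one>}" "openin X U" "U \<noteq> {}"
  shows "\<exists>W. openin X W \<and> W \<noteq> {} \<and> W \<subseteq> U \<and> (\<forall>h \<in> F. \<phi> h ` W \<inter> W = {})"
  using assms(1,2)
proof (induction F)
  case empty
  then show ?case using assms(3,4) by blast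
next
  case (insert h F)
  then obtain W where W: "openin X W" "W \<noteq> {}" "W \<subseteq> U" "\<forall>h \<in> F. \<phi> h ` W \<inter> W = {}"
    by blast
  have h: "h \<in> carrier G" "h \<noteq> \<one>" using insert.prems by auto
  obtain x where x: "x \<in> W" "\<phi> h x \<noteq> x"
    using topologically_free[OF h W(1,2)] by blast
  have x_X: "x \<in> topspace X" using x W openin_subset by blast
  obtain W' where W': "openin X W'" "x \<in> W'" "\<phi> h ` W' \<inter> W' = {}"
    using displaced_neighbourhood[OF h(1) x_X x(2)] .
  have "openin X (W \<inter> W')" "W \<inter> W' \<noteq> {}" using W W' x by auto
  moreover have "\<phi> k ` (W \<inter> W') \<inter> (W \<inter> W') = {}" if "k \<in> insert h F" for k
    using that W(4) W'(3) by blast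
  ultimately show ?case using W(3) by (intro exI[of _ "W \<inter> W'"]) blast
qed

text \<open>
  If \<open>\<gamma>\<close> commutes with all elements \<open>g\<close> of the set, then for a suitable \<open>x\<close> both \<open>g x\<close> and
  \<open>g (\<gamma> x) = \<gamma> (g x)\<close> come close to \<open>a\<close>.  If \<open>\<gamma>\<close> moved \<open>a\<close>, it would displace a neighbourhood of \<open>a\<close>,
  and these two points could not lie in it together.
\<close>

lemma collapses_commuting_fixes_attractor:
  assumes "\<Phi> \<subseteq> carrier G" "infinite \<Phi>" "collapses \<Phi> a r" "\<gamma> \<in> carrier G"
    and commute: "\<And>g. g \<in> \<Phi> \<Longrightarrow> \<gamma> \<otimes> g = g \<otimes> \<gamma>"
  shows "\<phi> \<gamma> a = a"
proof (rule ccontr)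
  assume ne: "\<phi> \<gamma> a \<noteq> a"
  have ar: "a \<in> topspace X" "r \<in> topspace X" using assms(3) by (auto simp: collapses_def)
  obtain W where W: "openin X W" "a \<in> W" "\<phi> \<gamma> ` W \<inter> W = {}"
    using displaced_neighbourhood[OF assms(4) ar(1) ne] .
  \<comment> \<open>Neither \<open>x\<close> nor \<open>\<gamma> x\<close> may be the repelling point, since both have to be attracted to \<open>a\<close>.\<close>
  obtain x where x: "x \<in> topspace X" "x \<noteq> r" "x \<noteq> \<phi> (inv \<gamma>) r"
    using avoid_two_points by blast
  then have x': "\<phi> \<gamma> x \<noteq> r" using assms(4) by auto
  have "closedin X {x, \<phi> \<gamma> x}" using x assms(4) by (intro closedin_finite) auto
  then obtain g where g: "g \<in> \<Phi>" "\<phi> g ` {x, \<phi> \<gamma> x} \<subseteq> W"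
    using collapses_moves_into[OF assms(3,1,2) _ _ W(1,2), of "{x, \<phi> \<gamma> x}"] x(2) x' by blast
  have "\<phi> \<gamma> (\<phi> g x) = \<phi> g (\<phi> \<gamma> x)"
    using commute[OF g(1)] g(1) assms(1,4) x(1) composition_rule by (metis subsetD)
  then show False using g(2) W(3) by blast
qed

text \<open>
  The powers of \<open>\<gamma>\<close> commute with \<open>\<gamma>\<close>, so \<open>\<gamma>\<close> fixes the attracting point.  The repelling point is the
  attracting point of the set of inverses, which consists of powers of \<open>\<gamma>\<close> as well.
\<close>

lemma cyclic_collapses_at_fixed_points:
  assumes \<gamma>: "\<gamma> \<in> carrier G" and \<Phi>: "\<Phi> \<subseteq> generate G {\<gamma>}" "infinite \<Phi>" "collapses \<Phi> a r"
  shows "\<phi> \<gamma> a = a" "\<phi> \<gamma> r = r"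
proof -
  have sub: "generate G {\<gamma>} \<subseteq> carrier G" using \<gamma> by (intro generate_incl) auto
  have \<Phi>_carrier: "\<Phi> \<subseteq> carrier G" using \<Phi>(1) sub by blast
  have commute: "\<gamma> \<otimes> g = g \<otimes> \<gamma>" if "g \<in> generate G {\<gamma>}" for g
    using generate_singleton_commutes[OF \<gamma> that] .
  show "\<phi> \<gamma> a = a"
    using \<Phi>_carrier \<Phi> \<gamma> commute by (intro collapses_commuting_fixes_attractor) auto
  have "inj_on (m_inv G) \<Phi>" using \<Phi>_carrier inj_on_subset[OF inv_inj] by blast
  then have "infinite (m_inv G ` \<Phi>)" using \<Phi>(2) finite_imageD by blast
  moreover have "m_inv G ` \<Phi> \<subseteq> generate G {\<gamma>}"
    using \<Phi>(1) generate_m_inv_closed[of "{\<gamma>}"] \<gamma> by auto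
  ultimately show "\<phi> \<gamma> r = r"
    using collapses_inverse[OF \<Phi>(3) \<Phi>_carrier] \<gamma> commute sub
    by (intro collapses_commuting_fixes_attractor[of "m_inv G ` \<Phi>" r a]) auto
qed

text \<open>
  Let \<open>K\<close> be a closed neighbourhood, free of fixed points of \<open>\<gamma>\<close>, of a point that \<open>\<gamma>\<close> moves.
  If infinitely many powers of \<open>\<gamma>\<close> mapped \<open>K\<close> to a set that meets \<open>K\<close>, a collapsing subset of these powers
  would have its attracting and repelling points among the fixed points of \<open>\<gamma>\<close>, hence outside \<open>K\<close>,
  and then only finitely many of its elements could do so.  The remaining finitely many powers are
  handled by shrinking.  The argument covers elements of finite and of infinite order alike.
\<close>

lemma cyclic_displaced_open:
  assumes \<gamma>: "\<gamma> \<in> carrier G" "\<gamma> \<noteq> \<one>"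
  shows "\<exists>U. openin X U \<and> U \<noteq> {} \<and> (\<forall>k \<in> generate G {\<gamma>}. k \<noteq> \<one> \<longrightarrow> \<phi> k ` U \<inter> U = {})"
proof -
  have sub: "generate G {\<gamma>} \<subseteq> carrier G" using \<gamma> by (intro generate_incl) auto
  obtain x where x: "x \<in> topspace X" "\<phi> \<gamma> x \<noteq> x"
    using faithful_imp_one[OF faithful \<gamma>(1)] \<gamma>(2) by blast
  obtain W where W: "openin X W" "x \<in> W" "\<phi> \<gamma> ` W \<inter> W = {}"
    using displaced_neighbourhood[OF \<gamma>(1) x] .
  then obtain U K where UK: "openin X U" "closedin X K" "x \<in> U" "U \<subseteq> K" "K \<subseteq> W"
    using compact_Hausdorff_imp_regular_space[OF compact Hausdorff]
    unfolding neighbourhood_base_of_closedin[symmetric] neighbourhood_base_of by metis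
  have not_fixed: "\<phi> \<gamma> y \<noteq> y" if "y \<in> K" for y
    using that UK(5) W(3) by (metis disjoint_iff imageI subsetD)
  let ?F = "{k \<in> generate G {\<gamma>}. \<phi> k ` K \<inter> K \<noteq> {}}"
  have "finite ?F"
  proof (rule ccontr)
    assume inf: "infinite ?F"
    have "?F \<subseteq> carrier G" using sub by blast
    then obtain \<Phi> a r where \<Phi>: "\<Phi> \<subseteq> ?F" "infinite \<Phi>" "collapses \<Phi> a r"
      using inf by (rule obtain_collapses)
    then have "\<phi> \<gamma> a = a" "\<phi> \<gamma> r = r"
      using cyclic_collapses_at_fixed_points[OF \<gamma>(1), of \<Phi> a r] by auto
    then have "a \<notin> K" "r \<notin> K" using not_fixed by blast+
    then have "finite {g \<in> \<Phi>. \<phi> g ` K \<inter> K \<noteq> {}}"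
      using \<Phi>(3) UK(2) by (intro collapses_finite)
    moreover have "{g \<in> \<Phi>. \<phi> g ` K \<inter> K \<noteq> {}} = \<Phi>" using \<Phi>(1) by blast
    ultimately show False using \<Phi>(2) by simp
  qed
  then obtain N where N: "openin X N" "N \<noteq> {}" "N \<subseteq> U" "\<forall>h \<in> ?F - {\<one>}. \<phi> h ` N \<inter> N = {}"
    using displaced_open_subset[of "?F - {\<one>}" U] sub UK(1,3) by blast
  have "\<phi> k ` N \<inter> N = {}" if "k \<in> generate G {\<gamma>}" "k \<noteq> \<one>" for k
    using that N(3,4) UK(4) by blast
  then show ?thesis using N(1,2) by blast
qed

text \<open>
  If the nontrivial powers of \<open>\<gamma>\<close> displace \<open>U\<close>, those of its conjugate by \<open>h\<close> displace \<open>h U\<close>.  With \<open>h\<close>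
  chosen such that the complement of \<open>h U\<close> lies in \<open>V\<close>, this is the ping-pong condition for \<open>V\<close>.
\<close>

lemma conjugate_ping_pong:
  assumes \<gamma>: "\<gamma> \<in> carrier G" "\<gamma> \<noteq> \<one>" and V: "openin X V" "V \<noteq> {}"
  shows "\<exists>\<delta> \<in> conjugacy_class G \<gamma>. \<forall>k \<in> generate G {\<delta>}. k \<noteq> \<one> \<longrightarrow> \<phi> k ` (topspace X - V) \<subseteq> V"
proof -
  obtain U where U: "openin X U" "U \<noteq> {}"
    and displaced: "\<And>k. k \<in> generate G {\<gamma>} \<Longrightarrow> k \<noteq> \<one> \<Longrightarrow> \<phi> k ` U \<inter> U = {}"
    using cyclic_displaced_open[OF \<gamma>] by blast
  obtain h where h: "h \<in> carrier G" "\<phi> h ` (topspace X - U) \<subseteq> V"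
    using push_into[OF U V] by blast
  have "\<phi> k y \<in> V" if k: "k \<in> generate G {h \<otimes> \<gamma> \<otimes> inv h}" "k \<noteq> \<one>"
    and y: "y \<in> topspace X - V" for k y
  proof -
    obtain k' where k': "k' \<in> generate G {\<gamma>}" "k = h \<otimes> k' \<otimes> inv h"
      using generate_conjugate[OF \<gamma>(1) h(1) k(1)] by blast
    then have "k' \<noteq> \<one>" using k(2) h(1) by auto
    have k'_carrier: "k' \<in> carrier G" using k'(1) generate_in_carrier[of "{\<gamma>}"] \<gamma>(1) by auto
    have "\<phi> (inv h) y \<in> U"
    proof (rule ccontr)
      assume "\<phi> (inv h) y \<notin> U"
      then have "\<phi> h (\<phi> (inv h) y) \<in> V" using h y by (intro subsetD[OF h(2)] imageI) auto
      then show False using y h by simp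
    qed
    then have "\<phi> k' (\<phi> (inv h) y) \<in> topspace X - U"
      using displaced[OF k'(1) \<open>k' \<noteq> \<one>\<close>] y h(1) k'_carrier by auto
    then have "\<phi> h (\<phi> k' (\<phi> (inv h) y)) \<in> V" using h(2) by blast
    then show ?thesis using k'(2) k'_carrier h(1) y by (simp add: composition_rule)
  qed
  moreover have "h \<otimes> \<gamma> \<otimes> inv h \<in> conjugacy_class G \<gamma>"
    using h(1) by (auto simp: conjugacy_class_def)
  ultimately show ?thesis by blast
qed


section \<open>Countability\<close>

text \<open>
  Fix three distinct points.  A collapsing set brings two of them, namely two that differ from its
  repelling point, arbitrarily close to each other.  Hence for each \<open>n\<close> only finitely many elements keep
  the images of the three points at mutual distances of at least \<open>1 / (n + 1)\<close>, and every group element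
  does so for some \<open>n\<close>.
\<close>

lemma countable_group:
  assumes "metrizable_space X"
  shows "countable (carrier G)"
proof -
  obtain M d where "Metric_space M d" and X: "X = Metric_space.mtopology M d"
    using assms by (auto simp: metrizable_space_def)
  then interpret Metric_space M d by simp
  have top: "topspace X = M" using X by simp
  obtain p where p: "p \<in> M" using avoid_two_points top by blast
  obtain q where q: "q \<in> M" "q \<noteq> p" using avoid_two_points top by blast
  obtain s where s: "s \<in> M" "s \<noteq> p" "s \<noteq> q" using avoid_two_points top by blast
  define S where "S n = {g \<in> carrier G. \<forall>x \<in> {p, q, s}. \<forall>y \<in> {p, q, s}.
    x \<noteq> y \<longrightarrow> inverse (real (Suc n)) \<le> d (\<phi> g x) (\<phi> g y)}" for n
  have "finite (S n)" for n
  proof (rule ccontr)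
    assume "infinite (S n)"
    then obtain \<Phi> a r where \<Phi>: "\<Phi> \<subseteq> S n" "infinite \<Phi>" "collapses \<Phi> a r"
      by (rule obtain_collapses[rotated]) (auto simp: S_def)
    obtain x y where xy: "x \<in> {p, q, s}" "y \<in> {p, q, s}" "x \<noteq> y" "x \<noteq> r" "y \<noteq> r"
      using q s by (metis insertCI)
    let ?e = "inverse (real (Suc n)) / 2"
    have "a \<in> M" using \<Phi>(3) top by (simp add: collapses_def)
    then have "a \<in> mball a ?e" by simp
    moreover have "openin X (mball a ?e)" using X by simp
    moreover have "closedin X {x, y}" using xy p q s top by (intro closedin_finite) auto
    moreover have "\<Phi> \<subseteq> carrier G" using \<Phi>(1) by (auto simp: S_def)
    ultimately obtain g where g: "g \<in> \<Phi>" "\<phi> g ` {x, y} \<subseteq> mball a ?e"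
      using collapses_moves_into[OF \<Phi>(3) _ \<Phi>(2), of "{x, y}" "mball a ?e"] xy(4,5) by blast
    then have "\<phi> g x \<in> mball a ?e" "\<phi> g y \<in> mball a ?e" by auto
    then have "d (\<phi> g x) (\<phi> g y) < ?e + ?e"
      using triangle[of "\<phi> g x" a "\<phi> g y"] commute[of "\<phi> g x" a] by auto
    moreover have "inverse (real (Suc n)) \<le> d (\<phi> g x) (\<phi> g y)"
      using g(1) \<Phi>(1) xy(1-3) unfolding S_def by blast
    ultimately show False by simp
  qed
  then have "countable (\<Union>n. S n)" by (simp add: countable_finite)
  moreover have "carrier G \<subseteq> (\<Union>n. S n)"
  proof
    fix g assume g: "g \<in> carrier G"
    have in_M: "\<phi> g x \<in> M" if "x \<in> M" for x using in_E[OF g] that top by simp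
    have inj: "\<phi> g x \<noteq> \<phi> g y" if "x \<in> M" "y \<in> M" "x \<noteq> y" for x y
      using inj_prop[OF g] that top by (auto dest: inj_onD)
    let ?m = "min (d (\<phi> g p) (\<phi> g q)) (min (d (\<phi> g p) (\<phi> g s)) (d (\<phi> g q) (\<phi> g s)))"
    have "0 < ?m" using p q s in_M inj by (auto simp: mdist_pos_eq)
    then obtain n where n: "inverse (real (Suc n)) < ?m" using reals_Archimedean by blast
    then have "g \<in> S n" using g commute by (auto simp: S_def)
    then show "g \<in> (\<Union>n. S n)" by blast
  qed
  ultimately show ?thesis by (rule countable_subset[rotated])
qed


section \<open>Independent representatives of the conjugacy classes\<close>

text \<open>
  The class \<open>C\<close> plays ping-pong in \<open>V (Suc (num C))\<close>.  The successor keeps \<open>V 0\<close> free for the base point.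
\<close>

theorem independent_conjugacy_representatives:
  assumes "metrizable_space X"
  shows "\<exists>I \<subseteq> carrier G.
           (\<forall>C \<in> nontrivial_conjugacy_classes G. \<exists>!\<gamma>. \<gamma> \<in> I \<inter> C) \<and>
           I \<subseteq> \<Union> (nontrivial_conjugacy_classes G) \<and>
           independent_in G I \<and>
           generate G I \<subset> carrier G"
proof -
  let ?C = "nontrivial_conjugacy_classes G"
  have "countable ?C"
    using countable_group[OF assms] by (simp add: nontrivial_conjugacy_classes_def)
  then obtain num :: "'a set \<Rightarrow> nat" where num: "inj_on num ?C"
    by (auto simp: countable_def)
  obtain V :: "nat \<Rightarrow> 'c set"
    where V: "\<And>n. openin X (V n)" "\<And>n. V n \<noteq> {}" "disjoint_family V"
    by (rule obtain_disjoint_open_sequence) blast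
  have "\<exists>\<delta> \<in> C. \<forall>k \<in> generate G {\<delta>}. k \<noteq> \<one> \<longrightarrow>
      \<phi> k ` (topspace X - V (Suc (num C))) \<subseteq> V (Suc (num C))" if "C \<in> ?C" for C
  proof -
    have "C \<noteq> {\<one>}" "C \<in> conjugacy_class G ` carrier G"
      using that by (simp_all add: nontrivial_conjugacy_classes_def)
    then obtain \<gamma> where \<gamma>: "\<gamma> \<in> carrier G" "C = conjugacy_class G \<gamma>" "C \<noteq> {\<one>}"
      by blast
    then have "\<gamma> \<noteq> \<one>" using conjugacy_class_one by auto
    then show ?thesis using conjugate_ping_pong[OF \<gamma>(1) _ V(1,2)] \<gamma>(2) by blast
  qed
  then obtain rep where rep: "\<And>C. C \<in> ?C \<Longrightarrow> rep C \<in> C"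
    and rep_ping_pong: "\<And>C k. \<lbrakk>C \<in> ?C; k \<in> generate G {rep C}; k \<noteq> \<one>\<rbrakk>
      \<Longrightarrow> \<phi> k ` (topspace X - V (Suc (num C))) \<subseteq> V (Suc (num C))"
    by metis
  have class_of: "C = conjugacy_class G \<gamma>" if "C \<in> ?C" "\<gamma> \<in> C" for C \<gamma>
    using that conjugacy_class_cong by (auto simp: nontrivial_conjugacy_classes_def)
  have C_carrier: "C \<subseteq> carrier G" if "C \<in> ?C" for C
    using that by (auto simp: nontrivial_conjugacy_classes_def conjugacy_class_def)
  define I where "I = rep ` ?C"
  have I_carrier: "I \<subseteq> carrier G"
    using rep C_carrier by (auto simp: I_def)
  have unique: "\<exists>!\<gamma>. \<gamma> \<in> I \<inter> C" if "C \<in> ?C" for C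
  proof (rule ex1I[of _ "rep C"])
    show "rep C \<in> I \<inter> C" using rep that by (auto simp: I_def)
  next
    fix \<gamma> assume "\<gamma> \<in> I \<inter> C"
    then obtain D where D: "D \<in> ?C" "\<gamma> = rep D" "\<gamma> \<in> C" by (auto simp: I_def)
    then have "D = C" using class_of[OF that] class_of[OF D(1)] rep[OF D(1)] by metis
    then show "\<gamma> = rep C" using D by simp
  qed
  obtain x where x: "x \<in> V 0" using V(2) by blast
  have x_X: "x \<in> topspace X" using x openin_subset[OF V(1)] by blast
  let ?V = "\<lambda>\<gamma>. V (Suc (num (conjugacy_class G \<gamma>)))"
  have class_rep: "conjugacy_class G (rep C) = C" if "C \<in> ?C" for C
    using class_of[OF that rep[OF that]] by simp
  interpret ping_pong G "topspace X" \<phi> "\<lambda>\<gamma>. generate G {\<gamma>}" I ?V x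
  proof (intro ping_pong.intro subgroup_family.intro subgroup_family_axioms.intro
      ping_pong_axioms.intro group_action_axioms group_axioms)
    show "subgroup (generate G {\<gamma>}) G" if "\<gamma> \<in> I" for \<gamma>
      using that I_carrier by (intro generate_is_subgroup) auto
    show "disjoint_family_on ?V I"
    proof (unfold disjoint_family_on_def, intro ballI impI)
      fix \<gamma> \<delta> assume "\<gamma> \<in> I" "\<delta> \<in> I" "\<gamma> \<noteq> \<delta>"
      then obtain C D where "C \<in> ?C" "D \<in> ?C" "\<gamma> = rep C" "\<delta> = rep D" "C \<noteq> D"
        by (auto simp: I_def)
      then show "?V \<gamma> \<inter> ?V \<delta> = {}"
        using V(3) num by (auto simp: class_rep disjoint_family_on_def inj_on_eq_iff)
    qed
    show "x \<in> topspace X" by (rule x_X)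
    show "x \<notin> ?V \<gamma>" if "\<gamma> \<in> I" for \<gamma>
      using x V(3) by (auto simp: disjoint_family_on_def)
    show "\<phi> k ` (topspace X - ?V \<gamma>) \<subseteq> ?V \<gamma>"
      if "\<gamma> \<in> I" "k \<in> generate G {\<gamma>}" "k \<noteq> \<one>" for \<gamma> k
    proof -
      obtain C where C: "C \<in> ?C" "\<gamma> = rep C" using \<open>\<gamma> \<in> I\<close> by (auto simp: I_def)
      then show ?thesis using rep_ping_pong[OF C(1)] that(2,3) class_rep[OF C(1)] by simp
    qed
  qed
  have generate_I: "generate G (\<Union>\<gamma>\<in>I. generate G {\<gamma>}) = generate G I"
    by (rule generate_Union_cyclic[OF I_carrier])
  have "independent_in G I"
    using free_product_lift_iso[OF reduced_word_nontrivial] I_carrier generate_I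
    by (simp add: independent_in_def)
  moreover have "generate G I \<subset> carrier G"
  proof -
    have "V 0 - {x} \<noteq> {}"
      using infinite_open[OF V(1,2), of 0] by (metis finite.emptyI finite_Diff2 finite_insert)
    then obtain g where g: "g \<in> carrier G" "\<phi> g x \<in> V 0 - {x}"
      using orbit_meets_open[OF x_X openin_delete[OF V(1)]] by blast
    have "\<phi> g x \<notin> ?V \<gamma>" for \<gamma>
      using g(2) V(3) by (auto simp: disjoint_family_on_def)
    then have "g \<notin> generate G I"
      using orbit_of_base_point[of g] g(2) generate_I by auto
    then show ?thesis
      using g(1) generate_incl[OF I_carrier] by blast
  qed
  moreover have "I \<subseteq> \<Union> ?C" using rep by (auto simp: I_def)
  ultimately show ?thesis using I_carrier unique by (intro exI[of _ I] conjI ballI)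
qed

end

theorem theorem1p1:
  fixes G :: "('g, 'm) monoid_scheme"
    and X :: "'x topology"
    and \<phi> :: "'g \<Rightarrow> 'x \<Rightarrow> 'x"
  assumes "convergence_action G X \<phi>"
    and "metrizable_space X"
    and "\<exists>T \<subseteq> topspace X. card T = 3"
    and "faithful_action G (topspace X) \<phi>"
    and "minimal_action G X \<phi>"
    and "\<not> elementary_action G X \<phi>"
  shows "\<exists>I \<subseteq> carrier G.
           (\<forall>C \<in> nontrivial_conjugacy_classes G. \<exists>!\<gamma>. \<gamma> \<in> I \<inter> C) \<and>
           I \<subseteq> \<Union> (nontrivial_conjugacy_classes G) \<and>
           independent_in G I \<and>
           generate G I \<subset> carrier G"
proof -
  have "infinite (carrier G)"
    using assms(6) by (auto simp: elementary_action_def)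
  moreover have "inj_on \<phi> (carrier G)"
    using assms(4) by (simp add: faithful_action_def faithful_action_axioms_def)
  ultimately interpret minimal_convergence_action G X \<phi>
    using assms by (simp add: minimal_convergence_action_def minimal_convergence_action_axioms_def)
  show ?thesis
    by (rule independent_conjugacy_representatives[OF assms(2)])
qed

end
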